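(* Let $(X,\mu)$ be a measure space, let $Y=\{y_1,\ldots,y_n\}$ be a finite set, and let $\alpha: X\times Y\rightarrow\mathbb{R}$ be a positive function. Let $\Omega$, $\omega$, $\beta$ and $p$ be the functions derived from $\alpha$ as defined in the context. Assume that: (i) $\alpha(\cdot,y_i)\in L^2(X,\mu)$ for each $y_i\in Y$; (ii) $0<\Omega(x)<\infty$ for all $x\in X$, and $0<\omega(y_i)<\infty$ for all $y_i\in Y$. Then: 1. The kernel $p$ is square integrable under the weighted measure $\Omega^2\mu$, i.e., $p\in L^2(X\times X,\Omega^2\mu\otimes\Omega^2\mu)$. 2. The kernel $p$ is bi-stochastic under the weighted measure $\Omega^2\mu$, i.e., $$\int_X p(x,x')\,\Omega(x')^2\,d\mu(x')=\int_X p(x',x)\,\Omega(x')^2\,d\mu(x')=1,\quad\text{for all } x\in X.$$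
   Context: Given a measure space $(X,\mu)$, a finite reference set $Y=\{y_1,\ldots,y_n\}$ and a positive affinity function $\alpha:X\times Y\to\mathbb{R}$, define: - the density $\Omega:X\to\mathbb{R}$ by $\Omega(x)=\sum_{i=1}^n\alpha(x,y_i)$ for all $x\in X$; - the density $\omega:Y\to\mathbb{R}$ by $\omega(y_i)=\left(\int_X\alpha(x,y_i)\,\Omega(x)\,d\mu(x)\right)^{1/2}$ for all $y_i\in Y$; - the normalized affinity $\beta:X\times Y\to\mathbb{R}$ by $\beta(x,y_i)=\dfrac{\alpha(x,y_i)}{\Omega(x)\,\omega(y_i)}$; - the kernel $p:X\times X\to\mathbb{R}$ by $p(x,x')=\sum_{i=1}^n\beta(x,y_i)\,\beta(x',y_i)$. The weighted measure $\Omega^2\mu$ on $X$ is the measure with density $\Omega^2$ with respect to $\mu$, i.e. $d(\Omega^2\mu)(x)=\Omega(x)^2\,d\mu(x)$. *)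

theory Defs
  imports "HOL-Analysis.Analysis"
begin

text \<open>Membership in the real space \<open>L\<^sup>2\<close>, for functions rather than almost-everywhere classes.
  Measurability of \<open>f\<close> is required separately, since it does not follow from that of its square.\<close>

definition square_integrable :: "'a measure \<Rightarrow> ('a \<Rightarrow> real) \<Rightarrow> bool" where
  "square_integrable M f \<longleftrightarrow> f \<in> borel_measurable M \<and> integrable M (\<lambda>x. (f x)\<^sup>2)"

definition source_density :: "'b set \<Rightarrow> ('a \<Rightarrow> 'b \<Rightarrow> real) \<Rightarrow> 'a \<Rightarrow> real" where
  "source_density Y \<alpha> x = (\<Sum>y\<in>Y. \<alpha> x y)"

text \<open>The integral below is the Bochner integral, which is 0 for a non-integrable integrand;
  finiteness of the density is therefore a condition to be imposed on the nonnegative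
  extended integral instead.\<close>

definition reference_density :: "'a measure \<Rightarrow> 'b set \<Rightarrow> ('a \<Rightarrow> 'b \<Rightarrow> real) \<Rightarrow> 'b \<Rightarrow> real" where
  "reference_density M Y \<alpha> y = sqrt (\<integral>x. \<alpha> x y * source_density Y \<alpha> x \<partial>M)"

definition normalized_affinity ::
    "'a measure \<Rightarrow> 'b set \<Rightarrow> ('a \<Rightarrow> 'b \<Rightarrow> real) \<Rightarrow> 'a \<Rightarrow> 'b \<Rightarrow> real" where
  "normalized_affinity M Y \<alpha> x y =
     \<alpha> x y / (source_density Y \<alpha> x * reference_density M Y \<alpha> y)"

definition affinity_kernel ::
    "'a measure \<Rightarrow> 'b set \<Rightarrow> ('a \<Rightarrow> 'b \<Rightarrow> real) \<Rightarrow> 'a \<Rightarrow> 'a \<Rightarrow> real" where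
  "affinity_kernel M Y \<alpha> x x' =
     (\<Sum>y\<in>Y. normalized_affinity M Y \<alpha> x y * normalized_affinity M Y \<alpha> x' y)"

text \<open>If every \<open>\<alpha>(\<cdot>, y)\<close> is square integrable, this measure is finite, so its product with itself
  under \<open>\<Otimes>\<^sub>M\<close> is the usual product measure even if \<open>M\<close> is not assumed to be sigma-finite.\<close>

definition weighted_measure :: "'a measure \<Rightarrow> 'b set \<Rightarrow> ('a \<Rightarrow> 'b \<Rightarrow> real) \<Rightarrow> 'a measure" where
  "weighted_measure M Y \<alpha> = density M (\<lambda>x. ennreal ((source_density Y \<alpha> x)\<^sup>2))"

end

theory Submission
  imports Defs
begin

text \<open>
  Both claims come down to two properties of the factors
  \<open>\<beta>(x, y) = \<alpha>(x, y) / (\<Omega>(x) \<omega>(y))\<close> of the kernel \<open>p(x, x') = \<Sum>\<^sub>y \<beta>(x, y) \<beta>(x', y)\<close>.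

  Against the weight \<open>\<Omega>\<^sup>2\<close>, one factor \<open>\<Omega>\<close> cancels and the definition of \<open>\<omega>\<close> gives
  \<open>\<integral> \<beta>(x', y) \<Omega>(x')\<^sup>2 d\<mu>(x') = \<omega>(y)\<^sup>2 / \<omega>(y) = \<omega>(y)\<close>
  (lemma \<open>has_bochner_integral_normalized_affinity\<close>). On the other hand
  \<open>\<Sum>\<^sub>y \<beta>(x, y) \<omega>(y) = \<Sum>\<^sub>y \<alpha>(x, y) / \<Omega>(x) = 1\<close>. Integrating \<open>p\<close> termwise in one variable and
  applying these two identities in turn gives one marginal; the other follows because \<open>p\<close> is
  symmetric.

  Square integrability is boundedness on a finite measure space: \<open>0 \<le> \<alpha>(x, y) \<le> \<Omega>(x)\<close> yields
  \<open>0 \<le> \<beta>(x, y) \<le> 1 / \<omega>(y)\<close>, hence \<open>p\<close> is bounded, while \<open>\<Omega>\<^sup>2\<mu>\<close> is a finite measure because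
  \<open>\<Omega>\<^sup>2 = \<Sum>\<^sub>y \<alpha>(\<cdot>, y) \<Omega>\<close> is a finite sum of functions with finite integral. A bounded measurable
  function is square integrable for the finite measure \<open>\<Omega>\<^sup>2\<mu> \<Otimes> \<Omega>\<^sup>2\<mu>\<close>.
\<close>

lemma affinity_kernel_commute: "affinity_kernel M Y \<alpha> x x' = affinity_kernel M Y \<alpha> x' x"
  by (simp add: affinity_kernel_def mult.commute)

lemma (in finite_measure) square_integrable_bounded:
  assumes "f \<in> borel_measurable M" and "\<And>x. x \<in> space M \<Longrightarrow> \<bar>f x\<bar> \<le> B"
  shows "square_integrable M f"
proof -
  have "norm ((f x)\<^sup>2) \<le> B\<^sup>2" if "x \<in> space M" for x
    using power_mono[OF assms(2)[OF that], of 2] by simp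
  then have "integrable M (\<lambda>x. (f x)\<^sup>2)"
    using assms(1) by (intro integrable_const_bound[where B = "B\<^sup>2"]) auto
  with assms(1) show ?thesis
    by (simp add: square_integrable_def)
qed

lemma normalized_affinity_bounds:
  assumes "finite Y" and "y \<in> Y" and "\<And>z. z \<in> Y \<Longrightarrow> 0 \<le> \<alpha> x z"
    and "0 < source_density Y \<alpha> x" and "0 < reference_density M Y \<alpha> y"
  shows "0 \<le> normalized_affinity M Y \<alpha> x y"
    and "normalized_affinity M Y \<alpha> x y \<le> 1 / reference_density M Y \<alpha> y"
proof -
  have "\<alpha> x y \<le> source_density Y \<alpha> x"
    unfolding source_density_def using assms(1-3) by (intro member_le_sum) auto
  then show "normalized_affinity M Y \<alpha> x y \<le> 1 / reference_density M Y \<alpha> y"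
    using assms(4,5) by (simp add: normalized_affinity_def field_simps)
  show "0 \<le> normalized_affinity M Y \<alpha> x y"
    using assms by (simp add: normalized_affinity_def)
qed

text \<open>The square root in \<open>\<omega>\<close> is chosen so that \<open>\<omega>(y)\<^sup>2 / \<omega>(y) = \<omega>(y)\<close> comes out here.
  Positivity of \<open>\<omega>(y)\<close> makes the integral below the root positive, so squaring recovers it.\<close>

lemma has_bochner_integral_normalized_affinity:
  assumes pos: "\<And>x. x \<in> space M \<Longrightarrow> 0 < source_density Y \<alpha> x"
    and ref: "0 < reference_density M Y \<alpha> y"
    and int: "integrable M (\<lambda>x. \<alpha> x y * source_density Y \<alpha> x)"
  shows "has_bochner_integral M
           (\<lambda>x. normalized_affinity M Y \<alpha> x y * (source_density Y \<alpha> x)\<^sup>2)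
           (reference_density M Y \<alpha> y)"
proof -
  let ?I = "\<integral>x. \<alpha> x y * source_density Y \<alpha> x \<partial>M" and ?r = "reference_density M Y \<alpha> y"
  have "?I = ?r\<^sup>2"
    using ref by (simp add: reference_density_def)
  then have "?I / ?r = ?r"
    using ref by (simp add: power2_eq_square)
  then have "has_bochner_integral M (\<lambda>x. \<alpha> x y * source_density Y \<alpha> x / ?r) ?r"
    using has_bochner_integral_divide_zero[OF has_bochner_integral_integrable[OF int], of ?r]
    by simp
  moreover have "normalized_affinity M Y \<alpha> x y * (source_density Y \<alpha> x)\<^sup>2
      = \<alpha> x y * source_density Y \<alpha> x / ?r" if "x \<in> space M" for x
    using pos[OF that] ref by (simp add: normalized_affinity_def power2_eq_square field_simps)
  ultimately show ?thesis
    by (simp cong: has_bochner_integral_cong)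
qed

lemma sum_normalized_affinity_reference:
  assumes "0 < source_density Y \<alpha> x" and "\<And>y. y \<in> Y \<Longrightarrow> 0 < reference_density M Y \<alpha> y"
  shows "(\<Sum>y\<in>Y. normalized_affinity M Y \<alpha> x y * reference_density M Y \<alpha> y) = 1"
proof -
  have "(\<Sum>y\<in>Y. normalized_affinity M Y \<alpha> x y * reference_density M Y \<alpha> y)
      = (\<Sum>y\<in>Y. \<alpha> x y / source_density Y \<alpha> x)"
    using assms(2) by (intro sum.cong) (auto simp: normalized_affinity_def less_le)
  also have "\<dots> = source_density Y \<alpha> x / source_density Y \<alpha> x"
    unfolding sum_divide_distrib[symmetric] by (simp add: source_density_def)
  finally show ?thesis
    using assms(1) by simp
qed

lemma integral_affinity_kernel:
  assumes "x \<in> space M" and "\<And>y. y \<in> Y \<Longrightarrow> 0 < reference_density M Y \<alpha> y"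
    and "\<And>x. x \<in> space M \<Longrightarrow> 0 < source_density Y \<alpha> x"
    and "\<And>y. y \<in> Y \<Longrightarrow> integrable M (\<lambda>x. \<alpha> x y * source_density Y \<alpha> x)"
  shows "(\<integral>x'. affinity_kernel M Y \<alpha> x x' * (source_density Y \<alpha> x')\<^sup>2 \<partial>M) = 1"
proof -
  have "has_bochner_integral M
      (\<lambda>x'. \<Sum>y\<in>Y. normalized_affinity M Y \<alpha> x y *
         (normalized_affinity M Y \<alpha> x' y * (source_density Y \<alpha> x')\<^sup>2))
      (\<Sum>y\<in>Y. normalized_affinity M Y \<alpha> x y * reference_density M Y \<alpha> y)"
    using assms
    by (intro has_bochner_integral_sum has_bochner_integral_mult_right
        has_bochner_integral_normalized_affinity) auto
  then show ?thesis
    using sum_normalized_affinity_reference[OF assms(3)[OF assms(1)] assms(2)]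
    by (simp add: affinity_kernel_def sum_distrib_right mult.assoc has_bochner_integral_integral_eq)
qed

lemma finite_measure_weighted_measure:
  assumes meas: "source_density Y \<alpha> \<in> borel_measurable M"
    and int: "\<And>y. y \<in> Y \<Longrightarrow> integrable M (\<lambda>x. \<alpha> x y * source_density Y \<alpha> x)"
  shows "finite_measure (weighted_measure M Y \<alpha>)"
proof -
  have "integrable M (\<lambda>x. \<Sum>y\<in>Y. \<alpha> x y * source_density Y \<alpha> x)"
    using int by (rule Bochner_Integration.integrable_sum)
  moreover have "(\<lambda>x. \<Sum>y\<in>Y. \<alpha> x y * source_density Y \<alpha> x) = (\<lambda>x. (source_density Y \<alpha> x)\<^sup>2)"
    unfolding sum_distrib_right[symmetric] by (simp add: source_density_def power2_eq_square)
  ultimately have "integrable M (\<lambda>x. (source_density Y \<alpha> x)\<^sup>2)"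
    by simp
  then have "(\<integral>\<^sup>+x. ennreal ((source_density Y \<alpha> x)\<^sup>2) \<partial>M) < \<infinity>"
    by (simp add: nn_integral_eq_integral)
  then show ?thesis
    using meas
    by (intro finite_measureI)
       (simp add: weighted_measure_def emeasure_density cong: nn_integral_cong)
qed

lemma square_integrable_affinity_kernel:
  assumes "finite Y"
    and nonneg: "\<And>x y. x \<in> space M \<Longrightarrow> y \<in> Y \<Longrightarrow> 0 \<le> \<alpha> x y"
    and meas: "\<And>y. y \<in> Y \<Longrightarrow> (\<lambda>x. \<alpha> x y) \<in> borel_measurable M"
    and pos: "\<And>x. x \<in> space M \<Longrightarrow> 0 < source_density Y \<alpha> x"
    and ref: "\<And>y. y \<in> Y \<Longrightarrow> 0 < reference_density M Y \<alpha> y"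
    and int: "\<And>y. y \<in> Y \<Longrightarrow> integrable M (\<lambda>x. \<alpha> x y * source_density Y \<alpha> x)"
  shows "square_integrable (weighted_measure M Y \<alpha> \<Otimes>\<^sub>M weighted_measure M Y \<alpha>)
           (\<lambda>(x, x'). affinity_kernel M Y \<alpha> x x')"
proof -
  let ?W = "weighted_measure M Y \<alpha>"
  have source_meas: "source_density Y \<alpha> \<in> borel_measurable M"
    unfolding source_density_def[abs_def] using meas by (rule borel_measurable_sum)
  interpret W: finite_measure ?W
    using source_meas int by (rule finite_measure_weighted_measure)
  interpret WW: finite_measure "?W \<Otimes>\<^sub>M ?W"
    by (rule finite_measure_pair_measure) unfold_locales
  have [measurable_cong]: "sets ?W = sets M" and space_W: "space ?W = space M"
    by (simp_all add: weighted_measure_def)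
  have [measurable]: "(\<lambda>x. normalized_affinity M Y \<alpha> x y) \<in> borel_measurable M" if "y \<in> Y" for y
    unfolding normalized_affinity_def using meas[OF that] source_meas by measurable
  show ?thesis
  proof (rule WW.square_integrable_bounded)
    show "(\<lambda>(x, x'). affinity_kernel M Y \<alpha> x x') \<in> borel_measurable (?W \<Otimes>\<^sub>M ?W)"
      unfolding affinity_kernel_def by measurable
  next
    fix z assume "z \<in> space (?W \<Otimes>\<^sub>M ?W)"
    then obtain x x' where z: "z = (x, x')" and x: "x \<in> space M" "x' \<in> space M"
      by (auto simp: space_pair_measure space_W)
    have bounds: "0 \<le> normalized_affinity M Y \<alpha> u y"
        "normalized_affinity M Y \<alpha> u y \<le> 1 / reference_density M Y \<alpha> y"
      if "u \<in> space M" "y \<in> Y" for u y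
      using normalized_affinity_bounds[of Y y \<alpha> u M] assms that by auto
    have "0 \<le> affinity_kernel M Y \<alpha> x x'"
      unfolding affinity_kernel_def using bounds x by (intro sum_nonneg mult_nonneg_nonneg)
    moreover have "affinity_kernel M Y \<alpha> x x'
        \<le> (\<Sum>y\<in>Y. 1 / reference_density M Y \<alpha> y * (1 / reference_density M Y \<alpha> y))"
      unfolding affinity_kernel_def
      using bounds x ref by (intro sum_mono mult_mono) (auto simp: less_imp_le)
    ultimately show "\<bar>case z of (x, x') \<Rightarrow> affinity_kernel M Y \<alpha> x x'\<bar>
        \<le> (\<Sum>y\<in>Y. 1 / reference_density M Y \<alpha> y * (1 / reference_density M Y \<alpha> y))"
      by (simp add: z)
  qed
qed

theorem proposition2:
  fixes M :: "'a measure" and Y :: "'b set" and \<alpha> :: "'a \<Rightarrow> 'b \<Rightarrow> real"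
  assumes finite_Y: "finite Y"
    and nonneg: "\<And>x y. x \<in> space M \<Longrightarrow> y \<in> Y \<Longrightarrow> 0 \<le> \<alpha> x y"
    and L2: "\<And>y. y \<in> Y \<Longrightarrow> square_integrable M (\<lambda>x. \<alpha> x y)"
    and source_pos: "\<And>x. x \<in> space M \<Longrightarrow> 0 < source_density Y \<alpha> x"
    and reference_pos: "\<And>y. y \<in> Y \<Longrightarrow> 0 < reference_density M Y \<alpha> y"
    and reference_finite:
      "\<And>y. y \<in> Y \<Longrightarrow> (\<integral>\<^sup>+x. ennreal (\<alpha> x y * source_density Y \<alpha> x) \<partial>M) < \<infinity>"
  shows "square_integrable (weighted_measure M Y \<alpha> \<Otimes>\<^sub>M weighted_measure M Y \<alpha>)
           (\<lambda>(x, x'). affinity_kernel M Y \<alpha> x x') \<and>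
         (\<forall>x\<in>space M.
           (\<integral>x'. affinity_kernel M Y \<alpha> x x' * (source_density Y \<alpha> x')\<^sup>2 \<partial>M) = 1 \<and>
           (\<integral>x'. affinity_kernel M Y \<alpha> x' x * (source_density Y \<alpha> x')\<^sup>2 \<partial>M) = 1)"
proof -
  have meas: "(\<lambda>x. \<alpha> x y) \<in> borel_measurable M" if "y \<in> Y" for y
    using L2[OF that] by (simp add: square_integrable_def)
  have source_meas: "source_density Y \<alpha> \<in> borel_measurable M"
    unfolding source_density_def[abs_def] using meas by (rule borel_measurable_sum)
  have int: "integrable M (\<lambda>x. \<alpha> x y * source_density Y \<alpha> x)" if "y \<in> Y" for y
  proof (rule integrableI_nonneg)
    show "(\<lambda>x. \<alpha> x y * source_density Y \<alpha> x) \<in> borel_measurable M"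
      using meas[OF that] source_meas by (rule borel_measurable_times)
    show "AE x in M. 0 \<le> \<alpha> x y * source_density Y \<alpha> x"
      using nonneg[OF _ that] source_pos by (intro AE_I2 mult_nonneg_nonneg) (auto simp: less_imp_le)
    show "(\<integral>\<^sup>+x. ennreal (\<alpha> x y * source_density Y \<alpha> x) \<partial>M) < \<infinity>"
      using that by (rule reference_finite)
  qed
  have marginal: "(\<integral>x'. affinity_kernel M Y \<alpha> x x' * (source_density Y \<alpha> x')\<^sup>2 \<partial>M) = 1"
    if "x \<in> space M" for x
    using that reference_pos source_pos int by (rule integral_affinity_kernel)
  have "(\<integral>x'. affinity_kernel M Y \<alpha> x' x * (source_density Y \<alpha> x')\<^sup>2 \<partial>M) = 1"
    if "x \<in> space M" for x
    using marginal[OF that] by (simp only: affinity_kernel_commute[of M Y \<alpha> _ x])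
  then show ?thesis
    using square_integrable_affinity_kernel[OF finite_Y nonneg meas source_pos reference_pos int]
      marginal by blast
qed

end
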